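(* For every real $x$ with $0<|x|<\frac{\pi}{2}$, $$3+\frac{1}{60}x^3\sin x<2\,\frac{x}{\sin x}+\frac{x}{\tan x}<3+\frac{8\pi-24}{\pi^3}x^3\sin x.$$ Moreover, the constants $\frac{1}{60}$ and $\frac{8\pi-24}{\pi^3}$ are the best possible.
   Context: "Best possible" means that the constant in the lower bound cannot be replaced by any larger real constant, and the constant in the upper bound cannot be replaced by any smaller real constant, with the corresponding inequality still holding for all $x$ in the stated range. *)

theory Defs
  imports Complex_Main
begin

end

theory Submission
  imports Defs "HOL-Real_Asymp.Real_Asymp"
begin

text \<open>
  For \<open>0 < x < pi / 2\<close> the middle expression equals \<open>3 + q x * x ^ 3 * sin x\<close>, where
  \<open>q x = (2 * x + x * cos x - 3 * sin x) / (x ^ 3 * (sin x)\<^sup>2)\<close>. The function \<open>q\<close> tends to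
  \<open>1 / 60\<close> at \<open>0\<close>, equals \<open>(8 * pi - 24) / pi ^ 3\<close> at \<open>pi / 2\<close>, and is strictly increasing: its
  derivative is \<open>p x / (x ^ 4 * (sin x) ^ 3)\<close>, where \<open>p\<close> is a combination of \<open>sin\<close> and \<open>cos\<close> of
  \<open>x\<close> and \<open>2 * x\<close> whose Taylor series starts with \<open>x ^ 8 / 105 - 11 / 8400 * x ^ 10\<close>, and
  these two terms dominate the remainder for \<open>x < 2\<close>.
\<close>

definition q :: "real \<Rightarrow> real" where
  "q x = (2 * x + x * cos x - 3 * sin x) / (x ^ 3 * (sin x)\<^sup>2)"

text \<open>Double angles replace products of \<open>sin\<close> and \<open>cos\<close>, so Taylor
  polynomials can be substituted term by term and their errors simply add up.\<close>

definition p :: "real \<Rightarrow> real" where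
  "p x = 9 / 2 - 9 / 2 * cos (2 * x) - 4 * (x * sin x) + 1 / 2 * (x * sin (2 * x))
         - 3 / 2 * x\<^sup>2 - 1 / 2 * (x\<^sup>2 * cos (2 * x)) - 4 * (x\<^sup>2 * cos x)"

lemma Maclaurin_cos_bound:
  "\<bar>cos x - (\<Sum>m<n. cos_coeff m * x ^ m)\<bar> \<le> inverse (fact n) * \<bar>x\<bar> ^ n"
proof -
  obtain w where w: "cos x = (\<Sum>m<n. cos_coeff m * x ^ m) + w / fact n * x ^ n" "\<bar>w\<bar> \<le> 1"
    using Maclaurin_cos_expansion[of x n] abs_cos_le_one by blast
  have "\<bar>cos x - (\<Sum>m<n. cos_coeff m * x ^ m)\<bar> = \<bar>w\<bar> * (inverse (fact n) * \<bar>x\<bar> ^ n)"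
    unfolding w(1) by (simp add: abs_mult power_abs divide_inverse)
  also have "\<dots> \<le> 1 * (inverse (fact n) * \<bar>x\<bar> ^ n)"
    by (intro mult_right_mono w(2)) simp
  finally show ?thesis by simp
qed

lemma p_pos:
  assumes "0 < x" "x < 2"
  shows "0 < p x"
proof -
  define S where "S y = sin y - (y - y^3/6 + y^5/120 - y^7/5040 + y^9/362880)" for y :: real
  define C where "C y = cos y - (1 - y^2/2 + y^4/24 - y^6/720 + y^8/40320 - y^10/3628800)" for y :: real
  \<comment> \<open>The denominators are 11! and 12!. Sine has no term of degree 10 and cosine none
    of degree 11, hence the orders 11 and 12 of the errors.\<close>
  have S: "\<bar>S y\<bar> \<le> y ^ 11 / 39916800" if "0 < y" for y
    using Maclaurin_sin_bound[of y 11] that unfolding S_def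
    by (simp add: sin_coeff_def lessThan_nat_numeral lessThan_Suc fact_numeral field_simps)
  have C: "\<bar>C y\<bar> \<le> y ^ 12 / 479001600" if "0 < y" for y
    using Maclaurin_cos_bound[of y 12] that unfolding C_def
    by (simp add: cos_coeff_def lessThan_nat_numeral lessThan_Suc fact_numeral field_simps)
  have S': "\<bar>x * S y\<bar> \<le> x * (y ^ 11 / 39916800)" if "0 < y" for y
    using mult_left_mono[OF S[OF that], of x] assms by (simp add: abs_mult)
  have C': "\<bar>x\<^sup>2 * C y\<bar> \<le> x\<^sup>2 * (y ^ 12 / 479001600)" if "0 < y" for y
    using mult_left_mono[OF C[OF that], of "x\<^sup>2"] by (simp add: abs_mult)
  have pow: "x * x ^ 11 = x ^ 12" "x\<^sup>2 * x ^ 12 = x ^ 14"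
    by (simp_all flip: power_add power_Suc)
  have s1: "\<bar>x * S x\<bar> \<le> x ^ 12 / 39916800"
    using S'[of x] assms by (simp add: pow)
  have s2: "\<bar>x * S (2 * x)\<bar> \<le> 2048 / 39916800 * x ^ 12"
    using S'[of "2 * x"] assms by (simp add: power_mult_distrib flip: pow)
  have c2: "\<bar>C (2 * x)\<bar> \<le> 4096 / 479001600 * x ^ 12"
    using C[of "2 * x"] assms by (simp add: power_mult_distrib)
  have d1: "\<bar>x\<^sup>2 * C x\<bar> \<le> x ^ 14 / 479001600"
    using C'[of x] assms by (simp add: pow)
  have d2: "\<bar>x\<^sup>2 * C (2 * x)\<bar> \<le> 4096 / 479001600 * x ^ 14"
    using C'[of "2 * x"] assms by (simp add: power_mult_distrib flip: pow)
  \<comment> \<open>All terms below degree 8 cancel. The coefficient of \<open>x ^ 12\<close> is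
    (512 + 4) / 10!, from the degree 10 terms of the two cosines multiplied by
    \<open>x\<^sup>2\<close>; it is not the full Taylor coefficient.\<close>
  have "p x = x ^ 8 / 105 - 11 / 8400 * x ^ 10 + 43 / 302400 * x ^ 12
      - 9 / 2 * C (2 * x) - 4 * (x * S x)
      + 1 / 2 * (x * S (2 * x))
      - 1 / 2 * (x\<^sup>2 * C (2 * x)) - 4 * (x\<^sup>2 * C x)"
    unfolding p_def S_def C_def
    by (simp add: power_mult_distrib field_simps power_numeral_reduce)
  \<comment> \<open>As 44 / 8400 < 1 / 105, the \<open>x ^ 8\<close> term outweighs the
    \<open>x ^ 10\<close> term. The \<open>x ^ 12\<close> term absorbs all the errors, those of
    order 14 being reduced to order 12.\<close>
  moreover have "x ^ 10 < 4 * x ^ 8" "x ^ 14 < 4 * x ^ 12"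
    using assms power_strict_mono[of x 2 2]
      mult_strict_right_mono[of "x\<^sup>2" 4 "x ^ 8"] mult_strict_right_mono[of "x\<^sup>2" 4 "x ^ 12"]
    by (simp_all flip: power_add)
  moreover have "0 < x ^ 8" "0 < x ^ 12" using assms by simp_all
  ultimately show ?thesis
    using abs_le_D1[OF s1] abs_le_D2[OF s2] abs_le_D1[OF c2] abs_le_D1[OF d1] abs_le_D1[OF d2]
    by linarith
qed

text \<open>The range extends beyond \<open>pi / 2\<close>, so that \<open>q\<close> is
  differentiable, and thus continuous, at that endpoint too.\<close>

lemma q_has_derivative:
  assumes "0 < x" "x < pi"
  shows "(q has_real_derivative p x / (x ^ 4 * (sin x) ^ 3)) (at x)"
proof -
  have s: "sin x > 0" using assms by (simp add: sin_gt_zero)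
  have c2: "cos x ^ 2 = 1 - sin x ^ 2" by (simp add: cos_squared_eq)
  show ?thesis
    unfolding q_def[abs_def]
    apply (rule derivative_eq_intros refl | use s assms in simp; fail)+
    using s assms
    apply (simp add: p_def cos_double_sin sin_double divide_simps)
    using c2 apply algebra
    done
qed

lemma q_strict_mono:
  assumes "0 < x" "x < y" "y \<le> pi / 2"
  shows "q x < q y"
proof (rule DERIV_pos_imp_increasing[OF assms(2)])
  fix z assume z: "x \<le> z" "z \<le> y"
  then have "0 < z" "z < pi" "z < 2"
    using assms pi_gt_zero pi_less_4 by linarith+
  then show "\<exists>d. (q has_real_derivative d) (at z) \<and> 0 < d"
    using q_has_derivative[of z] p_pos[of z] sin_gt_zero[of z] by fastforce
qed

lemma q_at_0: "(q \<longlongrightarrow> 1 / 60) (at_right 0)"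
  unfolding q_def by real_asymp

lemma q_pi_half: "q (pi / 2) = (8 * pi - 24) / pi ^ 3"
  by (simp add: q_def power_divide right_diff_distrib)

lemma q_at_pi_half: "(q \<longlongrightarrow> (8 * pi - 24) / pi ^ 3) (at_left (pi / 2))"
proof -
  have "isCont q (pi / 2)"
    using q_has_derivative[of "pi / 2"] by (auto intro: DERIV_isCont)
  then show ?thesis
    unfolding isCont_def q_pi_half by (rule filterlim_mono) (auto simp: at_within_le_at)
qed

lemma q_less:
  assumes "0 < x" "x < pi / 2"
  shows "q x < (8 * pi - 24) / pi ^ 3"
  using q_strict_mono[of x "pi / 2"] assms by (simp add: q_pi_half)

lemma q_greater:
  assumes "0 < x" "x < pi / 2"
  shows "1 / 60 < q x"
proof -
  \<comment> \<open>The limit at 0 yields only a weak inequality; passing from \<open>x / 2\<close>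
    to \<open>x\<close> makes it strict.\<close>
  have "1 / 60 \<le> q (x / 2)"
  proof (rule tendsto_upperbound[OF q_at_0])
    show "\<forall>\<^sub>F y in at_right 0. q y \<le> q (x / 2)"
      unfolding eventually_at_right_field
      using assms by (intro exI[of _ "x / 2"]) (auto intro!: less_imp_le q_strict_mono)
  qed simp
  also have "q (x / 2) < q x" using assms by (intro q_strict_mono) auto
  finally show ?thesis .
qed

lemma sin_tan_q:
  assumes "0 < x" "x < pi / 2"
  shows "2 * (x / sin x) + x / tan x = 3 + q x * x ^ 3 * sin x" "0 < x ^ 3 * sin x"
proof -
  have "0 < sin x" "0 < cos x"
    using assms by (auto intro: sin_gt_zero cos_gt_zero)
  then show "2 * (x / sin x) + x / tan x = 3 + q x * x ^ 3 * sin x" "0 < x ^ 3 * sin x"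
    using assms by (simp_all add: q_def tan_def field_simps power2_eq_square)
qed

text \<open>The factor \<open>x ^ 3 * sin x\<close> is positive and cancels. Since \<open>c\<close>
  is arbitrary, this serves both the bound and its optimality.\<close>

lemma less_sin_tan_iff:
  assumes "0 < x" "x < pi / 2"
  shows "3 + c * x ^ 3 * sin x < 2 * (x / sin x) + x / tan x \<longleftrightarrow> c < q x"
  unfolding sin_tan_q(1)[OF assms] mult.assoc add_less_cancel_left
  by (rule mult_less_cancel_right_pos[OF sin_tan_q(2)[OF assms]])

lemma sin_tan_less_iff:
  assumes "0 < x" "x < pi / 2"
  shows "2 * (x / sin x) + x / tan x < 3 + c * x ^ 3 * sin x \<longleftrightarrow> q x < c"
  unfolding sin_tan_q(1)[OF assms] mult.assoc add_less_cancel_left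
  by (rule mult_less_cancel_right_pos[OF sin_tan_q(2)[OF assms]])

theorem theorem3p1:
  shows "(\<forall>x::real. 0 < \<bar>x\<bar> \<and> \<bar>x\<bar> < pi / 2 \<longrightarrow>
            3 + 1 / 60 * x ^ 3 * sin x < 2 * (x / sin x) + x / tan x \<and>
            2 * (x / sin x) + x / tan x < 3 + (8 * pi - 24) / pi ^ 3 * x ^ 3 * sin x)
       \<and> (\<forall>c::real. c > 1 / 60 \<longrightarrow>
            \<not> (\<forall>x::real. 0 < \<bar>x\<bar> \<and> \<bar>x\<bar> < pi / 2 \<longrightarrow>
                  3 + c * x ^ 3 * sin x < 2 * (x / sin x) + x / tan x))
       \<and> (\<forall>c::real. c < (8 * pi - 24) / pi ^ 3 \<longrightarrow>
            \<not> (\<forall>x::real. 0 < \<bar>x\<bar> \<and> \<bar>x\<bar> < pi / 2 \<longrightarrow>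
                  2 * (x / sin x) + x / tan x < 3 + c * x ^ 3 * sin x))"
proof (intro conjI allI impI)
  fix x :: real
  assume x: "0 < \<bar>x\<bar> \<and> \<bar>x\<bar> < pi / 2"
  \<comment> \<open>All expressions are even in \<open>x\<close>, so \<open>\<bar>x\<bar>\<close>
    may replace \<open>x\<close>.\<close>
  show "3 + 1 / 60 * x ^ 3 * sin x < 2 * (x / sin x) + x / tan x"
    using less_sin_tan_iff[of "\<bar>x\<bar>" "1 / 60"] q_greater[of "\<bar>x\<bar>"] x
    by (cases "x < 0") auto
  show "2 * (x / sin x) + x / tan x < 3 + (8 * pi - 24) / pi ^ 3 * x ^ 3 * sin x"
    using sin_tan_less_iff[of "\<bar>x\<bar>" "(8 * pi - 24) / pi ^ 3"] q_less[of "\<bar>x\<bar>"] x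
    by (cases "x < 0") auto
next
  fix c :: real
  assume "c > 1 / 60"
  then have "\<forall>\<^sub>F x in at_right 0. q x < c"
    using order_tendstoD(2)[OF q_at_0] by blast
  moreover have "\<forall>\<^sub>F x in at_right 0. x \<in> {0<..<pi / 2}"
    by (rule eventually_at_right_real) simp
  ultimately have "\<forall>\<^sub>F x in at_right 0. q x < c \<and> x \<in> {0<..<pi / 2}"
    by (rule eventually_conj)
  then obtain x where "q x < c" "0 < x" "x < pi / 2"
    using eventually_happens' trivial_limit_at_right_real by fastforce
  then show "\<not> (\<forall>x::real. 0 < \<bar>x\<bar> \<and> \<bar>x\<bar> < pi / 2 \<longrightarrow>
                  3 + c * x ^ 3 * sin x < 2 * (x / sin x) + x / tan x)"
    using less_sin_tan_iff[of x c] by (intro notI) (auto dest!: spec[of _ x])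
next
  fix c :: real
  assume "c < (8 * pi - 24) / pi ^ 3"
  \<comment> \<open>The point \<open>pi / 2\<close> itself is excluded from the range, so the left
    limit must supply a counterexample inside it.\<close>
  then have "\<forall>\<^sub>F x in at_left (pi / 2). c < q x"
    using order_tendstoD(1)[OF q_at_pi_half] by blast
  moreover have "\<forall>\<^sub>F x in at_left (pi / 2). x \<in> {0<..<pi / 2}"
    by (rule eventually_at_left_real) simp
  ultimately have "\<forall>\<^sub>F x in at_left (pi / 2). c < q x \<and> x \<in> {0<..<pi / 2}"
    by (rule eventually_conj)
  then obtain x where "c < q x" "0 < x" "x < pi / 2"
    using eventually_happens' trivial_limit_at_left_real by fastforce
  then show "\<not> (\<forall>x::real. 0 < \<bar>x\<bar> \<and> \<bar>x\<bar> < pi / 2 \<longrightarrow>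
                  2 * (x / sin x) + x / tan x < 3 + c * x ^ 3 * sin x)"
    using sin_tan_less_iff[of x c] by (intro notI) (auto dest!: spec[of _ x])
qed

end
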